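(* $\mathbf{KF}$ has exactly seven global collapses. One is the empty collapse (no two of the 34 words are identified). The six nonempty ones are those generated by the following lists of equations: (KD) $fib=fbi$, $fif=0$, $bif=if$; (ED) $bib=ib$, $ibi=bi$, $fib=fbi=fif=0$, $bif=if$; (OU) $bib=bi$, $ibi=ib$, $fib=fbi$, $bif=fif=if=0$, $f=ff$; (EO) $bib=bi=ibi=ib$, $fib=fbi=bif=fif=if=0$, $f=ff$; (P) $bib=ib=b$, $ibi=bi=i$, $ff=fb=fi=fib=fbi=fif=0$, $f=bif=if$; (D) $\mathrm{id}=bib=bi=b=ibi=ib=i$, $f=bif=if=ff=fb=fi=fib=fbi=fif=0$. Hence the only possible values of $|\mathbf{KF}|$, over all nonempty topological spaces, are $4,10,16,20,22,28,34$.
   Context: $(X,\mathcal T)$ is a nonempty topological space. Set operators are maps $2^X\to 2^X$; products are compositions, $(o_1o_2)A=o_1(o_2A)$. Let $a$ be complement, $b$ closure, $i=aba$ interior, $f$ boundary ($fA=bA\cap b(aA)$), $\mathrm{id}$ the identity operator, $0A=\varnothing$, $1=a0$. Put $\mathbf K^0=\{\mathrm{id},b,i,bi,ib,bib,ibi\}$, $\mathbf F^0=\{0,f,if,fif,bif,ff,fb,fi,fbi,fib\}$, $\mathbf{KF}^0=\mathbf K^0\cup\mathbf F^0$, $\mathbf{KF}=\mathbf{KF}^0\cup a\mathbf{KF}^0$, regarded as a set of 34 formal words, each of which is interpreted as an operator in every space. $|\mathbf{KF}|$ denotes the number of distinct operators on $2^X$ these words define in the given space. A collapse of $\mathbf{KF}$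 is a set of unordered pairs of words in $\mathbf{KF}$. A space satisfies a collapse $C$ if for all (distinct) words $o_1,o_2$ one has: $o_1A=o_2A$ for all $A\subseteq X$ if and only if $\{o_1,o_2\}\in C$. A global collapse is one satisfied by some nonempty topological space. The collapse generated by a list of equations is the set of pairs of distinct words identified by the smallest equivalence relation on the 34 words that contains the listed equations and is closed under $o=p\Rightarrow ao=ap$ (with $aa=\mathrm{id}$). *)

theory Defs
  imports "HOL-Analysis.Abstract_Topology"
begin

text \<open>
  Words are lists of letters, read as compositions: the leftmost letter is applied last, so
  \<open>[\<ff>, \<ii>, \<bb>]\<close> is the word \<open>fib\<close>. The empty list is the word \<open>id\<close>, and
  \<open>[\<aa>, \<oo>]\<close> is the word \<open>1 = a0\<close>.
\<close>

datatype letter = \<aa> | \<bb> | \<ii> | \<ff> | \<oo>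

type_synonym kf_word = "letter list"

text \<open>On subsets of the space, the frontier \<open>bA - iA\<close> is \<open>bA \<inter> b(aA)\<close> (see
  \<open>frontier_of_closures\<close>) and the interior is \<open>aba\<close>.\<close>

primrec letter_op :: "'a topology \<Rightarrow> letter \<Rightarrow> 'a set \<Rightarrow> 'a set" where
  "letter_op X \<aa> A = topspace X - A"
| "letter_op X \<bb> A = X closure_of A"
| "letter_op X \<ii> A = X interior_of A"
| "letter_op X \<ff> A = X frontier_of A"
| "letter_op X \<oo> A = {}"

definition word_op :: "'a topology \<Rightarrow> kf_word \<Rightarrow> 'a set \<Rightarrow> 'a set" where
  "word_op X w = foldr (letter_op X) w"

definition K0 :: "kf_word set" where
  "K0 = {[], [\<bb>], [\<ii>], [\<bb>, \<ii>], [\<ii>, \<bb>], [\<bb>, \<ii>, \<bb>], [\<ii>, \<bb>, \<ii>]}"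

definition F0 :: "kf_word set" where
  "F0 = {[\<oo>], [\<ff>], [\<ii>, \<ff>], [\<ff>, \<ii>, \<ff>], [\<bb>, \<ii>, \<ff>], [\<ff>, \<ff>], [\<ff>, \<bb>], [\<ff>, \<ii>],
         [\<ff>, \<bb>, \<ii>], [\<ff>, \<ii>, \<bb>]}"

definition KF0 :: "kf_word set" where
  "KF0 = K0 \<union> F0"

definition KF :: "kf_word set" where
  "KF = KF0 \<union> (#) \<aa> ` KF0"

text \<open>Operators act on the subsets of the space only, hence the restriction to
  \<open>Pow (topspace X)\<close> before counting.\<close>

definition KF_number :: "'a topology \<Rightarrow> nat" where
  "KF_number X = card ((\<lambda>w. restrict (word_op X w) (Pow (topspace X))) ` KF)"

text \<open>Pairs in a collapse consist of distinct words.\<close>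

definition is_collapse :: "kf_word set set \<Rightarrow> bool" where
  "is_collapse C \<longleftrightarrow> C \<subseteq> {{v, w} | v w. v \<in> KF \<and> w \<in> KF \<and> v \<noteq> w}"

definition satisfies :: "'a topology \<Rightarrow> kf_word set set \<Rightarrow> bool" where
  "satisfies X C \<longleftrightarrow>
     (\<forall>v\<in>KF. \<forall>w\<in>KF. v \<noteq> w \<longrightarrow>
        ((\<forall>A. A \<subseteq> topspace X \<longrightarrow> word_op X v A = word_op X w A) \<longleftrightarrow> {v, w} \<in> C))"

text \<open>HOL cannot quantify over all types inside a formula, so the type of the points is a
  parameter; the space itself is any nonempty topology on any set of points of that type.\<close>

definition global_collapse :: "'a itself \<Rightarrow> kf_word set set \<Rightarrow> bool" where
  "global_collapse _ C \<longleftrightarrow>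
     is_collapse C \<and> (\<exists>X :: 'a topology. topspace X \<noteq> {} \<and> satisfies X C)"

definition KF_numbers :: "'a itself \<Rightarrow> nat set" where
  "KF_numbers _ = {KF_number X | X :: 'a topology. topspace X \<noteq> {}}"

text \<open>The complement of a word, normalised by \<open>aa = id\<close> so that it maps \<open>KF\<close> to itself.\<close>

fun compl_word :: "kf_word \<Rightarrow> kf_word" where
  "compl_word (\<aa> # w) = w"
| "compl_word w = \<aa> # w"

inductive_set word_equiv :: "(kf_word \<times> kf_word) set \<Rightarrow> (kf_word \<times> kf_word) set"
  for E :: "(kf_word \<times> kf_word) set" where
  base: "(v, w) \<in> E \<Longrightarrow> (v, w) \<in> word_equiv E"
| refl: "w \<in> KF \<Longrightarrow> (w, w) \<in> word_equiv E"
| sym: "(v, w) \<in> word_equiv E \<Longrightarrow> (w, v) \<in> word_equiv E"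
| trans: "(u, v) \<in> word_equiv E \<Longrightarrow> (v, w) \<in> word_equiv E \<Longrightarrow> (u, w) \<in> word_equiv E"
| compl: "(v, w) \<in> word_equiv E \<Longrightarrow> (compl_word v, compl_word w) \<in> word_equiv E"

text \<open>Each member of the list \<open>cs\<close> is a chain \<open>w\<^sub>1 = w\<^sub>2 = \<dots> = w\<^sub>n\<close> of equations.\<close>

definition equations :: "kf_word list list \<Rightarrow> (kf_word \<times> kf_word) set" where
  "equations cs = (\<Union>ws \<in> set cs. set (zip ws (tl ws)))"

definition generated_collapse :: "kf_word list list \<Rightarrow> kf_word set set" where
  "generated_collapse cs = {{v, w} | v w. (v, w) \<in> word_equiv (equations cs) \<and> v \<noteq> w}"

definition eqs_KD :: "kf_word list list" where
  "eqs_KD = [[[\<ff>, \<ii>, \<bb>], [\<ff>, \<bb>, \<ii>]],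
         [[\<ff>, \<ii>, \<ff>], [\<oo>]],
         [[\<bb>, \<ii>, \<ff>], [\<ii>, \<ff>]]]"

definition eqs_ED :: "kf_word list list" where
  "eqs_ED = [[[\<bb>, \<ii>, \<bb>], [\<ii>, \<bb>]],
         [[\<ii>, \<bb>, \<ii>], [\<bb>, \<ii>]],
         [[\<ff>, \<ii>, \<bb>], [\<ff>, \<bb>, \<ii>], [\<ff>, \<ii>, \<ff>], [\<oo>]],
         [[\<bb>, \<ii>, \<ff>], [\<ii>, \<ff>]]]"

definition eqs_OU :: "kf_word list list" where
  "eqs_OU = [[[\<bb>, \<ii>, \<bb>], [\<bb>, \<ii>]],
         [[\<ii>, \<bb>, \<ii>], [\<ii>, \<bb>]],
         [[\<ff>, \<ii>, \<bb>], [\<ff>, \<bb>, \<ii>]],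
         [[\<bb>, \<ii>, \<ff>], [\<ff>, \<ii>, \<ff>], [\<ii>, \<ff>], [\<oo>]],
         [[\<ff>], [\<ff>, \<ff>]]]"

definition eqs_EO :: "kf_word list list" where
  "eqs_EO = [[[\<bb>, \<ii>, \<bb>], [\<bb>, \<ii>], [\<ii>, \<bb>, \<ii>], [\<ii>, \<bb>]],
         [[\<ff>, \<ii>, \<bb>], [\<ff>, \<bb>, \<ii>], [\<bb>, \<ii>, \<ff>], [\<ff>, \<ii>, \<ff>], [\<ii>, \<ff>], [\<oo>]],
         [[\<ff>], [\<ff>, \<ff>]]]"

definition eqs_P :: "kf_word list list" where
  "eqs_P = [[[\<bb>, \<ii>, \<bb>], [\<ii>, \<bb>], [\<bb>]],
        [[\<ii>, \<bb>, \<ii>], [\<bb>, \<ii>], [\<ii>]],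
        [[\<ff>, \<ff>], [\<ff>, \<bb>], [\<ff>, \<ii>], [\<ff>, \<ii>, \<bb>], [\<ff>, \<bb>, \<ii>], [\<ff>, \<ii>, \<ff>], [\<oo>]],
        [[\<ff>], [\<bb>, \<ii>, \<ff>], [\<ii>, \<ff>]]]"

definition eqs_D :: "kf_word list list" where
  "eqs_D = [[[], [\<bb>, \<ii>, \<bb>], [\<bb>, \<ii>], [\<bb>], [\<ii>, \<bb>, \<ii>], [\<ii>, \<bb>], [\<ii>]],
        [[\<ff>], [\<bb>, \<ii>, \<ff>], [\<ii>, \<ff>], [\<ff>, \<ff>], [\<ff>, \<bb>], [\<ff>, \<ii>], [\<ff>, \<ii>, \<bb>], [\<ff>, \<bb>, \<ii>],
         [\<ff>, \<ii>, \<ff>], [\<oo>]]]"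

end

theory Submission imports Defs begin

text \<open>
  Which equations hold in a space \<open>X\<close> is governed by five of them:
  \<open>b = id\<close> (discrete, D), \<open>ib = b\<close> (every open set is closed, P), \<open>bib = ib\<close> (extremally
  disconnected, ED), \<open>if = 0\<close> (no nonempty open subspace has two disjoint dense subsets, OU) and
  \<open>bif = if\<close> (every \<open>ifA\<close> is clopen, KD). Here D implies P, P implies ED, ED and OU each imply KD, and
  P together with OU implies D. This leaves seven combinations of truth values. Each of them determines
  the collapse, because of the following two facts.

  Each property implies the equations in the corresponding list. Since \<open>ifA = ibA - biA\<close>, the
  property OU says \<open>ib \<le> bi\<close>, and KD says that the gap between \<open>ib\<close> and \<open>bi\<close> is always clopen; the
  remaining equations follow by monotonicity of \<open>b\<close> and \<open>i\<close> and by complementation, which exchanges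
  \<open>b\<close> and \<open>i\<close> and fixes \<open>f\<close> (lemmas \<open>equations_KD\<close> to \<open>equations_D\<close>).

  No other equations hold. Let \<open>q\<close> be a continuous open surjection from an open subspace of \<open>X\<close> onto a
  space \<open>Y\<close>. Then \<open>A \<mapsto> q\<inverse>A\<close> commutes with closure, interior and complement, so \<open>Y\<close> satisfies
  every equation that \<open>X\<close> satisfies (lemma \<open>equation_inherited\<close>). If one of the five properties fails
  in \<open>X\<close>, a counterexample to it yields such a map onto a particular finite space in which the property
  fails too:
  \<^item> the two-point indiscrete space if OU fails,
  \<^item> the Sierpinski space if P fails,
  \<^item> two open points with a common limit point if ED fails,
  \<^item> the last space with one of its open points doubled into an indiscrete pair if KD fails.
  Evaluating the words at a few subsets of these spaces separates all the words that are not identified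
  by the list of equations (the lemmas named \<open>separated\<close>). For D, where none of the five properties
  fails, the one-point space suffices, onto which every nonempty space maps.

  All spaces involved, including one for each of the seven combinations, are subspaces of a single
  space on the six points \<open>0, \<dots>, 5\<close>. Hence all seven collapses occur already on the type of natural
  numbers. In each list the chains are disjoint sets of words in \<open>KF0\<close>, and complementation acts freely
  on \<open>KF\<close>, so the number of operators is twice the number of words in \<open>KF0\<close> that are left after
  removing from every chain all words but its first one.
\<close>

section \<open>Equations between words\<close>

definition holds :: "'a topology \<Rightarrow> kf_word \<Rightarrow> kf_word \<Rightarrow> bool" where
  "holds X v w \<longleftrightarrow> (\<forall>A. A \<subseteq> topspace X \<longrightarrow> word_op X v A = word_op X w A)"

lemma word_op_simps [simp]:
  "word_op X [] A = A"
  "word_op X (l # w) A = letter_op X l (word_op X w A)"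
  by (simp_all add: word_op_def)

lemma letter_op_subset: "A \<subseteq> topspace X \<Longrightarrow> letter_op X l A \<subseteq> topspace X"
  by (cases l)
    (auto simp: closure_of_subset_topspace interior_of_subset_topspace frontier_of_subset_topspace
      dest: subsetD[OF closure_of_subset_topspace] subsetD[OF interior_of_subset_topspace]
        subsetD[OF frontier_of_subset_topspace])

lemma word_op_subset: "A \<subseteq> topspace X \<Longrightarrow> word_op X w A \<subseteq> topspace X"
  by (induction w) (simp_all add: letter_op_subset)

lemma word_op_compl:
  assumes "A \<subseteq> topspace X"
  shows "word_op X (compl_word w) A = topspace X - word_op X w A"
proof (cases w rule: compl_word.cases)
  case (1 u)
  then show ?thesis using word_op_subset[OF assms, of u] by (simp add: double_diff)
qed simp_all

lemma holds_compl: "holds X v w \<Longrightarrow> holds X (compl_word v) (compl_word w)"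
  by (simp add: holds_def word_op_compl)

text \<open>
  Operators in \<open>KF0\<close> fix the empty set, so no word in \<open>KF0\<close> equals the complement of another one in a
  nonempty space. This reduces all questions about \<open>KF\<close> to \<open>KF0\<close>.
\<close>

lemma KF0_empty: "w \<in> KF0 \<Longrightarrow> word_op X w {} = {}"
  by (auto simp: KF0_def K0_def F0_def)

lemma compl_word_KF0: "w \<in> KF0 \<Longrightarrow> compl_word w = \<aa> # w"
  by (auto simp: KF0_def K0_def F0_def)

lemma KF_cases:
  assumes "w \<in> KF"
  obtains "w \<in> KF0" | u where "w = \<aa> # u" "u \<in> KF0"
  using assms by (auto simp: KF_def)

lemma compl_word_KF: "w \<in> KF \<Longrightarrow> compl_word w \<in> KF"
  by (erule KF_cases) (auto simp: compl_word_KF0 KF_def)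

lemma not_holds_compl:
  assumes "topspace X \<noteq> {}" "v \<in> KF0" "w \<in> KF0"
  shows "\<not> holds X v (\<aa> # w)"
proof
  assume "holds X v (\<aa> # w)"
  then have "word_op X v {} = word_op X (\<aa> # w) {}"
    unfolding holds_def by blast
  then show False
    using assms by (simp add: KF0_empty)
qed

definition collapse_of :: "'a topology \<Rightarrow> kf_word set set" where
  "collapse_of X = {{v, w} | v w. v \<in> KF \<and> w \<in> KF \<and> v \<noteq> w \<and> holds X v w}"

lemma holds_sym: "holds X v w \<Longrightarrow> holds X w v"
  by (simp add: holds_def)

lemma holds_trans: "holds X u v \<Longrightarrow> holds X v w \<Longrightarrow> holds X u w"
  by (simp add: holds_def)

lemma collapse_of_iff:
  assumes "v \<in> KF" "w \<in> KF" "v \<noteq> w"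
  shows "{v, w} \<in> collapse_of X \<longleftrightarrow> holds X v w"
  using assms holds_sym by (fastforce simp: collapse_of_def doubleton_eq_iff)

lemma satisfies_iff: "is_collapse C \<and> satisfies X C \<longleftrightarrow> C = collapse_of X"
proof
  assume C: "is_collapse C \<and> satisfies X C"
  then have "{v, w} \<in> C \<longleftrightarrow> {v, w} \<in> collapse_of X" if "v \<in> KF" "w \<in> KF" "v \<noteq> w" for v w
    using that collapse_of_iff[OF that, of X] by (auto simp: satisfies_def holds_def)
  moreover have "C \<subseteq> {{v, w} | v w. v \<in> KF \<and> w \<in> KF \<and> v \<noteq> w}"
    using C by (simp add: is_collapse_def)
  moreover have "collapse_of X \<subseteq> {{v, w} | v w. v \<in> KF \<and> w \<in> KF \<and> v \<noteq> w}"
    by (auto simp: collapse_of_def)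
  ultimately show "C = collapse_of X" by blast
next
  assume "C = collapse_of X"
  moreover have "satisfies X (collapse_of X)"
    by (simp add: satisfies_def collapse_of_iff holds_def)
  ultimately show "is_collapse C \<and> satisfies X C"
    by (auto simp: is_collapse_def collapse_of_def)
qed

section \<open>Presenting a collapse by chains\<close>

text \<open>
  In all the lists of equations the chains are the nontrivial classes of words in \<open>KF0\<close>. The
  predicate \<open>same_chain\<close> is therefore already the equivalence relation on \<open>KF0\<close> that the list
  generates.
\<close>

definition same_chain :: "kf_word list list \<Rightarrow> kf_word \<Rightarrow> kf_word \<Rightarrow> bool" where
  "same_chain cs v w \<longleftrightarrow> v = w \<or> (\<exists>ws\<in>set cs. v \<in> set ws \<and> w \<in> set ws)"

definition redundant :: "kf_word list list \<Rightarrow> kf_word set" where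
  "redundant cs = (\<Union>ws\<in>set cs. set (tl ws))"

text \<open>
  The condition on heads ensures that the class of every redundant word contains an irredundant one.
\<close>

definition well_formed :: "kf_word list list \<Rightarrow> bool" where
  "well_formed cs \<longleftrightarrow>
     (\<forall>ws\<in>set cs. ws \<noteq> [] \<and> set ws \<subseteq> KF0 \<and> hd ws \<notin> redundant cs)"

text \<open>
  The equations of the list hold in the space, and no two words in \<open>KF0\<close> from different classes agree
  there. This is what has to be checked of a space to know its collapse.
\<close>

definition presents :: "'a topology \<Rightarrow> kf_word list list \<Rightarrow> bool" where
  "presents X cs \<longleftrightarrow> topspace X \<noteq> {} \<and> well_formed cs \<and> (\<forall>(v, w)\<in>equations cs. holds X v w) \<and>
     (\<forall>v\<in>KF0. \<forall>w\<in>KF0. holds X v w \<longrightarrow> same_chain cs v w)"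

lemma equations_KF0:
  assumes "well_formed cs" "(v, w) \<in> equations cs"
  shows "v \<in> KF0 \<and> w \<in> KF0"
proof -
  obtain ws where ws: "ws \<in> set cs" "(v, w) \<in> set (zip ws (tl ws))"
    using assms(2) by (auto simp: equations_def)
  then have "v \<in> set ws" "w \<in> set (tl ws)"
    by (auto dest: set_zip_leftD set_zip_rightD)
  then show ?thesis
    using assms(1) ws(1) by (auto simp: well_formed_def dest: list.set_sel(2))
qed

lemma word_equiv_sound:
  assumes "presents X cs" "(v, w) \<in> word_equiv (equations cs)"
  shows "v \<in> KF \<and> w \<in> KF \<and> holds X v w"
  using assms(2)
proof induction
  case (base v w)
  then show ?case
    using assms(1) equations_KF0[of cs v w] by (auto simp: presents_def KF_def)
next
  case (refl w)
  then show ?case by (simp add: holds_def)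
next
  case (sym v w)
  then show ?case by (simp add: holds_sym)
next
  case (trans u v w)
  then show ?case using holds_trans by blast
next
  case (compl v w)
  then show ?case by (simp add: compl_word_KF holds_compl)
qed

lemma word_equiv_chain:
  assumes "set (zip ws (tl ws)) \<subseteq> word_equiv E" "v \<in> set ws" "w \<in> set ws" "set ws \<subseteq> KF"
  shows "(v, w) \<in> word_equiv E"
proof -
  have "(hd ws, u) \<in> word_equiv E" if "u \<in> set ws" for u
    using that assms(1,4)
  proof (induction ws)
    case (Cons x ws)
    show ?case
    proof (cases "ws = []")
      case True
      then show ?thesis using Cons.prems by (auto intro: word_equiv.refl)
    next
      case False
      then obtain y ys where ws: "ws = y # ys" by (cases ws) auto
      with Cons have "(x, y) \<in> word_equiv E" "u = x \<or> (y, u) \<in> word_equiv E"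
        by auto
      then show ?thesis using Cons.prems by (auto intro: word_equiv.refl word_equiv.trans)
    qed
  qed simp
  then show ?thesis
    using assms(2,3) by (blast intro: word_equiv.sym word_equiv.trans)
qed

lemma same_chain_word_equiv:
  assumes "well_formed cs" "same_chain cs v w" "v \<in> KF0"
  shows "(v, w) \<in> word_equiv (equations cs)"
proof (cases "v = w")
  case True
  then show ?thesis using assms by (auto simp: KF_def intro: word_equiv.refl)
next
  case False
  then obtain ws where ws: "ws \<in> set cs" "v \<in> set ws" "w \<in> set ws"
    using assms(2) by (auto simp: same_chain_def)
  have "set ws \<subseteq> KF"
    using assms(1) ws(1) by (auto simp: well_formed_def KF_def)
  moreover have "set (zip ws (tl ws)) \<subseteq> word_equiv (equations cs)"
    using ws(1) by (auto simp: equations_def intro!: word_equiv.base)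
  ultimately show ?thesis using ws by (intro word_equiv_chain)
qed

text \<open>
  A true equation between complements is the complement of a true equation between words in \<open>KF0\<close>,
  and a true equation never relates a word in \<open>KF0\<close> to a complement.
\<close>

lemma word_equiv_complete:
  assumes "presents X cs" "v \<in> KF" "w \<in> KF" "holds X v w"
  shows "(v, w) \<in> word_equiv (equations cs)"
proof -
  have KF0: "(v, w) \<in> word_equiv (equations cs)"
    if "v \<in> KF0" "w \<in> KF0" "holds X v w" for v w
    using that assms(1) by (auto simp: presents_def intro: same_chain_word_equiv)
  have X: "topspace X \<noteq> {}"
    using assms(1) by (simp add: presents_def)
  from assms(2) show ?thesis
  proof (cases rule: KF_cases)
    case v: 1
    from assms(3) show ?thesis
    proof (cases rule: KF_cases)
      case 1
      then show ?thesis using KF0 v assms by blast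
    next
      case (2 w')
      then show ?thesis using not_holds_compl[OF X v] assms by blast
    qed
  next
    case v: (2 v')
    from assms(3) show ?thesis
    proof (cases rule: KF_cases)
      case 1
      then show ?thesis using not_holds_compl[OF X 1 v(2)] holds_sym assms v by blast
    next
      case (2 w')
      then have "(v', w') \<in> word_equiv (equations cs)"
        using KF0[of v' w'] holds_compl[OF assms(4)] v by simp
      then show ?thesis
        using word_equiv.compl[of v' w'] 2 v by (simp add: compl_word_KF0)
    qed
  qed
qed

lemma collapse_of_presented:
  assumes "presents X cs"
  shows "collapse_of X = generated_collapse cs"
  unfolding collapse_of_def generated_collapse_def
  using word_equiv_sound[OF assms] word_equiv_complete[OF assms] by blast

text \<open>
  The irredundant words represent the operators given by \<open>KF0\<close> without repetition, their complements
  do so for the rest of \<open>KF\<close>, and the two families of operators are disjoint.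
\<close>

lemma KF_number_presented:
  assumes "presents X cs"
  shows "KF_number X = 2 * card (KF0 - redundant cs)"
proof -
  define F where "F = (\<lambda>w. restrict (word_op X w) (Pow (topspace X)))"
  define R where "R = KF0 - redundant cs"
  have F: "F v = F w \<longleftrightarrow> holds X v w" for v w
  proof
    assume "F v = F w"
    then have "F v A = F w A" for A by simp
    then show "holds X v w" by (force simp: F_def holds_def restrict_def split: if_splits)
  next
    assume "holds X v w"
    then show "F v = F w" by (simp add: F_def holds_def restrict_def fun_eq_iff)
  qed
  have wf: "well_formed cs" using assms by (simp add: presents_def)
  have fin: "finite R"
    by (simp add: R_def KF0_def K0_def F0_def)
  have inj: "v = w" if "v \<in> R" "w \<in> R" "holds X v w" for v w
  proof (rule ccontr)
    assume "v \<noteq> w"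
    moreover have "same_chain cs v w"
      using assms that by (auto simp: presents_def R_def)
    ultimately obtain ws where ws: "ws \<in> set cs" "v \<in> set ws" "w \<in> set ws"
      by (auto simp: same_chain_def)
    then have "v \<in> insert (hd ws) (set (tl ws))" "w \<in> insert (hd ws) (set (tl ws))"
      by (metis empty_iff list.collapse list.set(1) list.simps(15))+
    then show False using ws(1) that \<open>v \<noteq> w\<close> by (auto simp: R_def redundant_def)
  qed
  have rep: "\<exists>v\<in>R. holds X w v" if "w \<in> KF0" for w
  proof (cases "w \<in> redundant cs")
    case True
    then obtain ws where ws: "ws \<in> set cs" "w \<in> set (tl ws)"
      by (auto simp: redundant_def)
    then have "ws \<noteq> []" by auto
    then have "hd ws \<in> R"
      using wf ws(1) list.set_sel(1)[of ws] unfolding R_def well_formed_def by blast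
    moreover have "same_chain cs w (hd ws)"
      using ws \<open>ws \<noteq> []\<close> by (auto simp: same_chain_def intro: list.set_sel(2))
    ultimately show ?thesis
      using word_equiv_sound[OF assms same_chain_word_equiv[OF wf]] that by blast
  qed (use that in \<open>auto simp: R_def holds_def\<close>)
  have compl: "holds X (\<aa> # v) (\<aa> # w) \<longleftrightarrow> holds X v w" if "v \<in> KF0" "w \<in> KF0" for v w
    using that holds_compl[of X v w] holds_compl[of X "\<aa> # v" "\<aa> # w"]
    by (auto simp: compl_word_KF0)
  have "F ` KF0 = F ` R"
    using rep F by (auto simp: R_def image_iff)
  moreover have "F ` (#) \<aa> ` KF0 = F ` (#) \<aa> ` R"
    using rep F compl by (fastforce simp: R_def image_iff)
  ultimately have img: "F ` KF = F ` R \<union> F ` (#) \<aa> ` R"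
    by (simp add: KF_def image_Un)
  have "F ` R \<inter> F ` (#) \<aa> ` R = {}"
    using assms F not_holds_compl[of X] by (fastforce simp: presents_def R_def)
  moreover have "card (F ` R) = card R"
    by (intro card_image inj_onI) (use inj F in blast)
  moreover have "card (F ` (#) \<aa> ` R) = card R"
    unfolding image_image
    by (intro card_image inj_onI) (use inj F compl in \<open>auto simp: R_def\<close>)
  ultimately have "card (F ` KF) = card R + card R"
    unfolding img using fin by (simp add: card_Un_disjoint)
  then show ?thesis by (simp add: KF_number_def F_def R_def)
qed

section \<open>Finite test spaces\<close>

text \<open>
  The specialisation preorder of a space on the six points \<open>0, \<dots>, 5\<close>: the smallest open set
  containing \<open>x\<close> is \<open>{y. near x y}\<close>. The sets \<open>{0, 1}\<close> and \<open>{2}\<close> are open and carry no smaller nonempty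
  open sets, \<open>3\<close> is a common limit point of both, and \<open>{4, 5}\<close> is a clopen indiscrete pair; numbers
  above \<open>5\<close> do not occur. A test space is a subset \<open>S\<close> of these points with the subspace topology.
\<close>

definition near :: "nat \<Rightarrow> nat \<Rightarrow> bool" where
  "near x y \<longleftrightarrow> (if x \<le> 1 then y \<le> 1 else if x = 2 then y = 2 else if x = 3 then y \<le> 3
     else 4 \<le> y)"

lemma near_refl: "near x x"
  by (simp add: near_def)

lemma near_trans: "near x y \<Longrightarrow> near y z \<Longrightarrow> near x z"
  by (auto simp: near_def split: if_splits)

text \<open>
  In a finite space \<open>x\<close> lies in the closure (interior) of \<open>B\<close> iff its smallest neighbourhood meets
  (is contained in) \<open>B\<close>. This gives the operators in a form that can be evaluated.
\<close>

primrec fin_letter_op :: "nat set \<Rightarrow> letter \<Rightarrow> nat set \<Rightarrow> nat set" where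
  "fin_letter_op S \<aa> B = S - B"
| "fin_letter_op S \<bb> B = {x\<in>S. \<exists>y\<in>S. near x y \<and> y \<in> B}"
| "fin_letter_op S \<ii> B = {x\<in>S. \<forall>y\<in>S. near x y \<longrightarrow> y \<in> B}"
| "fin_letter_op S \<ff> B = {x\<in>S. (\<exists>y\<in>S. near x y \<and> y \<in> B) \<and> (\<exists>y\<in>S. near x y \<and> y \<notin> B)}"
| "fin_letter_op S \<oo> B = {}"

definition fin_word_op :: "nat set \<Rightarrow> kf_word \<Rightarrow> nat set \<Rightarrow> nat set" where
  "fin_word_op S w = foldr (fin_letter_op S) w"

text \<open>
  The map \<open>q\<close> goes from an open set \<open>D\<close> onto the test space \<open>S\<close>. The third conjunct says that \<open>q\<close> is
  continuous, as the preimages of the smallest neighbourhoods are open; it also makes \<open>D\<close> open. The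
  fourth says that \<open>q\<close> is open: the image of every neighbourhood of \<open>x\<close> contains all points near
  \<open>q x\<close>.
\<close>

definition open_partial_map :: "'a topology \<Rightarrow> 'a set \<Rightarrow> ('a \<Rightarrow> nat) \<Rightarrow> nat set \<Rightarrow> bool" where
  "open_partial_map X D q S \<longleftrightarrow> D \<subseteq> topspace X \<and> q ` D = S \<and>
     (\<forall>s\<in>S. openin X {x\<in>D. near s (q x)}) \<and>
     (\<forall>x\<in>D. \<forall>y\<in>S. near (q x) y \<longrightarrow> x \<in> X closure_of {x'\<in>D. q x' = y})"

definition maps_openly_onto :: "'a topology \<Rightarrow> nat set \<Rightarrow> bool" where
  "maps_openly_onto X S \<longleftrightarrow> (\<exists>D q. open_partial_map X D q S)"

text \<open>
  Continuity makes a point of the closure of \<open>q\<inverse>B\<close> map into the closure of \<open>B\<close>, openness gives the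
  converse; dually for interiors. As \<open>D\<close> is open, the part of \<open>A\<close> outside \<open>D\<close> has no influence on
  what happens in \<open>D\<close>.
\<close>

lemma open_partial_map_letter_op:
  assumes cov: "open_partial_map X D q S" and A: "D \<inter> A = {x\<in>D. q x \<in> B}"
  shows "D \<inter> letter_op X l A = {x\<in>D. q x \<in> fin_letter_op S l B}"
proof -
  have D: "D \<subseteq> topspace X" and q: "\<And>x. x \<in> D \<Longrightarrow> q x \<in> S"
    and nbhd: "\<And>x. x \<in> D \<Longrightarrow> openin X {x'\<in>D. near (q x) (q x')}"
    and dense: "\<And>x y. x \<in> D \<Longrightarrow> y \<in> S \<Longrightarrow> near (q x) y \<Longrightarrow> x \<in> X closure_of {x'\<in>D. q x' = y}"
    using cov by (auto simp: open_partial_map_def)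
  have A': "x \<in> A \<longleftrightarrow> q x \<in> B" if "x \<in> D" for x
    using A that by blast
  have b: "x \<in> X closure_of A \<longleftrightarrow> (\<exists>y\<in>S. near (q x) y \<and> y \<in> B)" if x: "x \<in> D" for x
  proof
    assume "x \<in> X closure_of A"
    moreover have "x \<in> {x'\<in>D. near (q x) (q x')}"
      using x by (simp add: near_refl)
    ultimately have "\<exists>x'. x' \<in> A \<and> x' \<in> {x'\<in>D. near (q x) (q x')}"
      using nbhd[OF x] by (simp only: in_closure_of)
    then obtain x' where "x' \<in> A" "x' \<in> D" "near (q x) (q x')" by blast
    then show "\<exists>y\<in>S. near (q x) y \<and> y \<in> B" using A'[of x'] q[of x'] by blast
  next
    assume "\<exists>y\<in>S. near (q x) y \<and> y \<in> B"
    then obtain y where y: "y \<in> S" "near (q x) y" "y \<in> B" by blast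
    then have "{x'\<in>D. q x' = y} \<subseteq> A" using A' by auto
    then show "x \<in> X closure_of A"
      using dense[OF x y(1,2)] closure_of_mono[of "{x'\<in>D. q x' = y}" A X] by blast
  qed
  have i: "x \<in> X interior_of A \<longleftrightarrow> (\<forall>y\<in>S. near (q x) y \<longrightarrow> y \<in> B)" if x: "x \<in> D" for x
  proof
    assume int: "x \<in> X interior_of A"
    show "\<forall>y\<in>S. near (q x) y \<longrightarrow> y \<in> B"
    proof (intro ballI impI)
      fix y assume "y \<in> S" "near (q x) y"
      then have "x \<in> X closure_of {x'\<in>D. q x' = y}" by (rule dense[OF x])
      then have "\<exists>x'. x' \<in> {x'\<in>D. q x' = y} \<and> x' \<in> X interior_of A"
        using int openin_interior_of[of X A] by (simp only: in_closure_of)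
      then obtain x' where "x' \<in> D" "q x' = y" "x' \<in> X interior_of A" by blast
      then show "y \<in> B" using A'[of x'] interior_of_subset[of X A] by blast
    qed
  next
    assume *: "\<forall>y\<in>S. near (q x) y \<longrightarrow> y \<in> B"
    have "{x'\<in>D. near (q x) (q x')} \<subseteq> A" using * A' q by auto
    then have "{x'\<in>D. near (q x) (q x')} \<subseteq> X interior_of A"
      using nbhd[OF x] by (rule interior_of_maximal)
    then show "x \<in> X interior_of A" using x near_refl[of "q x"] by blast
  qed
  show ?thesis
  proof (cases l)
    case \<aa>
    then show ?thesis using A' D q by auto
  next
    case \<bb>
    then show ?thesis using b q by auto
  next
    case \<ii>
    then show ?thesis using i q by auto
  next
    case \<ff>
    then show ?thesis using b i q by (auto simp: frontier_of_def)
  qed simp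
qed

lemma open_partial_map_word_op:
  assumes "open_partial_map X D q S"
  shows "D \<inter> word_op X w {x\<in>D. q x \<in> B} = {x\<in>D. q x \<in> fin_word_op S w B}"
proof (induction w)
  case Nil
  then show ?case by (auto simp: fin_word_op_def)
next
  case (Cons l w)
  then show ?case
    using open_partial_map_letter_op[OF assms Cons] by (simp add: fin_word_op_def)
qed

lemma fin_letter_op_subset: "B \<subseteq> S \<Longrightarrow> fin_letter_op S l B \<subseteq> S"
  by (cases l) auto

lemma fin_word_op_subset: "B \<subseteq> S \<Longrightarrow> fin_word_op S w B \<subseteq> S"
  by (induction w) (simp_all add: fin_word_op_def fin_letter_op_subset)

text \<open>
  Apply the equation to the preimage of \<open>B\<close>.
\<close>

lemma equation_inherited:
  assumes "maps_openly_onto X S" "holds X v w" "B \<subseteq> S"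
  shows "fin_word_op S v B = fin_word_op S w B"
proof -
  obtain D q where cov: "open_partial_map X D q S"
    using assms(1) by (auto simp: maps_openly_onto_def)
  then have D: "D \<subseteq> topspace X" "q ` D = S"
    by (auto simp: open_partial_map_def)
  have "{x\<in>D. q x \<in> B} \<subseteq> topspace X"
    using D(1) by blast
  then have "word_op X v {x\<in>D. q x \<in> B} = word_op X w {x\<in>D. q x \<in> B}"
    using assms(2) unfolding holds_def by blast
  then have "{x\<in>D. q x \<in> fin_word_op S v B} = {x\<in>D. q x \<in> fin_word_op S w B}"
    using open_partial_map_word_op[OF cov] by metis
  then have "s \<in> fin_word_op S v B \<longleftrightarrow> s \<in> fin_word_op S w B" if "s \<in> S" for s
    using that D(2) by blast
  then show ?thesis
    using fin_word_op_subset[OF assms(3)] by blast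
qed

definition test_space :: "nat set \<Rightarrow> nat topology" where
  "test_space S = topology (\<lambda>U. U \<subseteq> S \<and> (\<forall>x\<in>U. \<forall>y\<in>S. near x y \<longrightarrow> y \<in> U))"

lemma openin_test_space:
  "openin (test_space S) U \<longleftrightarrow> U \<subseteq> S \<and> (\<forall>x\<in>U. \<forall>y\<in>S. near x y \<longrightarrow> y \<in> U)"
proof -
  have "istopology (\<lambda>U. U \<subseteq> S \<and> (\<forall>x\<in>U. \<forall>y\<in>S. near x y \<longrightarrow> y \<in> U))"
    unfolding istopology_def by blast
  then show ?thesis by (simp add: test_space_def)
qed

lemma topspace_test_space [simp]: "topspace (test_space S) = S"
  unfolding topspace_def openin_test_space by blast

lemma open_partial_map_test_space: "open_partial_map (test_space S) S (\<lambda>x. x) S"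
proof -
  have "openin (test_space S) {x\<in>S. near s x}" for s
    using near_trans by (auto simp: openin_test_space)
  moreover have "x \<in> test_space S closure_of {x'\<in>S. x' = y}" if "x \<in> S" "y \<in> S" "near x y" for x y
    using that by (auto simp: in_closure_of openin_test_space)
  ultimately show ?thesis by (simp add: open_partial_map_def)
qed

text \<open>
  The identity is an open map, so \<open>fin_word_op\<close> computes the operators of the test space itself.
\<close>

lemma holds_test_space:
  "holds (test_space S) v w \<longleftrightarrow> (\<forall>B\<in>Pow S. fin_word_op S v B = fin_word_op S w B)"
proof -
  have "word_op (test_space S) u B = fin_word_op S u B" if "B \<subseteq> S" for u B
  proof -
    have "{x\<in>S. x \<in> B} = B" using that by blast
    then have "S \<inter> word_op (test_space S) u B = {x\<in>S. x \<in> fin_word_op S u B}"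
      using open_partial_map_word_op[OF open_partial_map_test_space, of S u B] by simp
    then show ?thesis
      using word_op_subset[of B "test_space S" u] fin_word_op_subset[of B S u] that by auto
  qed
  then show ?thesis by (auto simp: holds_def)
qed

section \<open>Five properties of a space\<close>

text \<open>
  These are the spaces that are discrete, partitioned by clopen indiscrete sets, extremally
  disconnected, or open-unresolvable, and those in which every \<open>ifA\<close> is clopen. Stating the properties
  as equations makes them decidable by evaluation on test spaces.
\<close>

definition D_space :: "'a topology \<Rightarrow> bool" where
  "D_space X \<longleftrightarrow> holds X [\<bb>] []"

definition P_space :: "'a topology \<Rightarrow> bool" where
  "P_space X \<longleftrightarrow> holds X [\<ii>, \<bb>] [\<bb>]"

definition ED_space :: "'a topology \<Rightarrow> bool" where
  "ED_space X \<longleftrightarrow> holds X [\<bb>, \<ii>, \<bb>] [\<ii>, \<bb>]"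

definition OU_space :: "'a topology \<Rightarrow> bool" where
  "OU_space X \<longleftrightarrow> holds X [\<ii>, \<ff>] [\<oo>]"

definition KD_space :: "'a topology \<Rightarrow> bool" where
  "KD_space X \<longleftrightarrow> holds X [\<bb>, \<ii>, \<ff>] [\<ii>, \<ff>]"

lemma interior_of_frontier_of:
  "X interior_of (X frontier_of A) = X interior_of (X closure_of A) - X closure_of (X interior_of A)"
proof -
  have "X interior_of (X frontier_of A)
      = X interior_of (X closure_of A) \<inter> (topspace X - X closure_of (X interior_of A))"
    by (simp add: frontier_of_closures interior_of_Int closure_of_complement interior_of_complement)
  then show ?thesis
    using interior_of_subset_topspace[of X "X closure_of A"] by blast
qed

text \<open>
  The complementary form of the defining equation.
\<close>

lemma ED_bi_open:
  assumes "ED_space X"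
  shows "X interior_of (X closure_of (X interior_of A)) = X closure_of (X interior_of A)"
proof -
  have "X closure_of (X interior_of (X closure_of (topspace X - A)))
      = X interior_of (X closure_of (topspace X - A))"
    using assms by (simp add: ED_space_def holds_def)
  then have "topspace X - X interior_of (X closure_of (X interior_of A))
      = topspace X - X closure_of (X interior_of A)"
    by (simp only: closure_of_complement interior_of_complement)
  then show ?thesis
    using interior_of_subset_topspace[of X "X closure_of (X interior_of A)"]
      closure_of_subset_topspace[of X "X interior_of A"] by blast
qed

text \<open>
  By \<open>interior_of_frontier_of\<close>, \<open>ifA\<close> is the difference of the sets \<open>ibA\<close> and \<open>biA\<close>, which are both
  clopen.
\<close>

lemma KD_of_ED:
  assumes "ED_space X"
  shows "KD_space X"
proof -
  have "X closure_of (X interior_of (X frontier_of A)) = X interior_of (X frontier_of A)"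
    if A: "A \<subseteq> topspace X" for A
  proof -
    have "closedin X (X interior_of (X closure_of A))"
      using assms A by (simp add: ED_space_def holds_def flip: closure_of_eq)
    moreover have "openin X (X closure_of (X interior_of A))"
      using ED_bi_open[OF assms] by (simp flip: interior_of_eq)
    ultimately show ?thesis
      by (simp add: interior_of_frontier_of closure_of_eq closedin_diff)
  qed
  then show ?thesis by (simp add: KD_space_def holds_def)
qed

lemma KD_of_OU: "OU_space X \<Longrightarrow> KD_space X"
  by (simp add: KD_space_def OU_space_def holds_def)

text \<open>
  Under P the closed set \<open>fA\<close> is open, so \<open>fA = ifA\<close>, and this is empty under OU.
\<close>

lemma D_of_P_OU:
  assumes "P_space X" "OU_space X"
  shows "D_space X"
proof -
  have "X closure_of A = A" if A: "A \<subseteq> topspace X" for A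
  proof -
    have "X closure_of (X frontier_of A) = X frontier_of A"
      by (simp add: closure_of_eq closedin_frontier_of)
    moreover have "X interior_of (X closure_of (X frontier_of A)) = X closure_of (X frontier_of A)"
      using assms(1) by (simp add: P_space_def holds_def frontier_of_subset_topspace)
    moreover have "X interior_of (X frontier_of A) = {}"
      using assms(2) A by (simp add: OU_space_def holds_def)
    ultimately have "X frontier_of A = {}"
      by simp
    then show ?thesis
      using interior_of_subset[of X A] closure_of_subset[OF A] by (auto simp: frontier_of_def)
  qed
  then show ?thesis by (simp add: D_space_def holds_def)
qed

text \<open>
  The difficulty is \<open>fib = fbi\<close>. The set \<open>ibA\<close> is contained in the union of \<open>biA\<close> and \<open>ifA\<close>, which is
  closed under KD, so \<open>bibA\<close> is this union. By complementation, \<open>ibiA = ibA - ifA\<close>. Both \<open>fibA\<close> and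
  \<open>fbiA\<close> are then equal to \<open>biA - ibA\<close>.
\<close>

lemma equations_KD:
  assumes "KD_space X"
  shows "\<forall>(v, w)\<in>equations eqs_KD. holds X v w"
proof -
  have if_closed: "X closure_of (X interior_of (X frontier_of A)) = X interior_of (X frontier_of A)"
    if "A \<subseteq> topspace X" for A
    using assms that by (simp add: KD_space_def holds_def)
  have bib: "X closure_of (X interior_of (X closure_of A))
      = X closure_of (X interior_of A) \<union> X interior_of (X frontier_of A)"
    if A: "A \<subseteq> topspace X" for A
  proof
    have "X closure_of (X interior_of (X closure_of A))
        \<subseteq> X closure_of (X closure_of (X interior_of A) \<union> X interior_of (X frontier_of A))"
      by (rule closure_of_mono) (auto simp: interior_of_frontier_of)
    then show "X closure_of (X interior_of (X closure_of A))
        \<subseteq> X closure_of (X interior_of A) \<union> X interior_of (X frontier_of A)"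
      by (simp add: closure_of_Un if_closed[OF A])
    have "X interior_of (X closure_of A) \<subseteq> X closure_of (X interior_of (X closure_of A))"
      by (simp add: closure_of_subset interior_of_subset_topspace)
    moreover have "X closure_of (X interior_of A) \<subseteq> X closure_of (X interior_of (X closure_of A))"
      using A by (intro closure_of_mono interior_of_mono closure_of_subset)
    ultimately show "X closure_of (X interior_of A) \<union> X interior_of (X frontier_of A)
        \<subseteq> X closure_of (X interior_of (X closure_of A))"
      by (auto simp: interior_of_frontier_of)
  qed
  \<comment> \<open>Complementation applied to the previous equation.\<close>
  have ibi: "X interior_of (X closure_of (X interior_of A))
      = X interior_of (X closure_of A) - X interior_of (X frontier_of A)"
    if A: "A \<subseteq> topspace X" for A
  proof -
    have "topspace X - X interior_of (X closure_of (X interior_of A))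
        = (topspace X - X interior_of (X closure_of A)) \<union> X interior_of (X frontier_of A)"
      using bib[of "topspace X - A"] A
      by (simp add: closure_of_complement interior_of_complement frontier_of_complement)
    then show ?thesis
      using interior_of_subset_topspace[of X "X closure_of (X interior_of A)"]
        interior_of_subset_topspace[of X "X closure_of A"] by blast
  qed
  have "X frontier_of (X interior_of (X closure_of A))
      = X frontier_of (X closure_of (X interior_of A))" if A: "A \<subseteq> topspace X" for A
  proof -
    have "X frontier_of (X interior_of (X closure_of A))
        = X closure_of (X interior_of A) - X interior_of (X closure_of A)"
      by (auto simp: frontier_of_def[of _ "X interior_of _"] bib[OF A] interior_of_frontier_of)
    moreover have "X frontier_of (X closure_of (X interior_of A))
        = X closure_of (X interior_of A) - X interior_of (X closure_of A)"
      by (auto simp: frontier_of_def[of _ "X closure_of _"] ibi[OF A] interior_of_frontier_of)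
    ultimately show ?thesis by simp
  qed
  moreover have "X frontier_of (X interior_of (X frontier_of A)) = {}"
    if A: "A \<subseteq> topspace X" for A
    by (simp add: frontier_of_def[of _ "X interior_of _"] if_closed[OF A])
  ultimately show ?thesis
    by (simp add: equations_def eqs_KD_def holds_def if_closed)
qed

lemma equations_ED:
  assumes "ED_space X"
  shows "\<forall>(v, w)\<in>equations eqs_ED. holds X v w"
proof -
  have bib: "X closure_of (X interior_of (X closure_of A)) = X interior_of (X closure_of A)"
    if "A \<subseteq> topspace X" for A
    using assms that by (simp add: ED_space_def holds_def)
  have ibi: "X interior_of (X closure_of (X interior_of A)) = X closure_of (X interior_of A)" for A
    by (rule ED_bi_open[OF assms])
  have fib: "X frontier_of (X interior_of (X closure_of A)) = {}" if "A \<subseteq> topspace X" for A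
    by (simp add: frontier_of_def bib that)
  have fbi: "X frontier_of (X closure_of (X interior_of A)) = {}" for A
    by (simp add: frontier_of_def ibi)
  show ?thesis
    using equations_KD[OF KD_of_ED[OF assms]] bib ibi fib fbi
    by (simp add: equations_def eqs_KD_def eqs_ED_def holds_def)
qed

text \<open>
  Since \<open>ifA = ibA - biA\<close>, the property says \<open>ib \<le> bi\<close>. Applying \<open>b\<close> and \<open>i\<close> gives \<open>bib \<le> bi\<close> and
  \<open>ib \<le> ibi\<close>; the opposite inclusions hold in every space.
\<close>

lemma equations_OU:
  assumes "OU_space X"
  shows "\<forall>(v, w)\<in>equations eqs_OU. holds X v w"
proof -
  have if0: "X interior_of (X frontier_of A) = {}" if "A \<subseteq> topspace X" for A
    using assms that by (simp add: OU_space_def holds_def)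
  have ib: "X interior_of (X closure_of A) \<subseteq> X closure_of (X interior_of A)"
    if "A \<subseteq> topspace X" for A
    using if0[OF that] by (simp add: interior_of_frontier_of)
  have bib: "X closure_of (X interior_of (X closure_of A)) = X closure_of (X interior_of A)"
    if A: "A \<subseteq> topspace X" for A
  proof
    show "X closure_of (X interior_of (X closure_of A)) \<subseteq> X closure_of (X interior_of A)"
      using closure_of_mono[OF ib[OF A], of X] by simp
    show "X closure_of (X interior_of A) \<subseteq> X closure_of (X interior_of (X closure_of A))"
      using A by (intro closure_of_mono interior_of_mono closure_of_subset)
  qed
  have ibi: "X interior_of (X closure_of (X interior_of A)) = X interior_of (X closure_of A)"
    if A: "A \<subseteq> topspace X" for A
  proof
    show "X interior_of (X closure_of (X interior_of A)) \<subseteq> X interior_of (X closure_of A)"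
      by (intro closure_of_mono interior_of_mono interior_of_subset)
    show "X interior_of (X closure_of A) \<subseteq> X interior_of (X closure_of (X interior_of A))"
      using interior_of_mono[OF ib[OF A], of X] by simp
  qed
  have ff: "X frontier_of (X frontier_of A) = X frontier_of A" if A: "A \<subseteq> topspace X" for A
    by (simp add: frontier_of_def[of _ "X frontier_of _"] if0[OF A] closure_of_closedin
      closedin_frontier_of)
  show ?thesis
    using equations_KD[OF KD_of_OU[OF assms]] if0 bib ibi ff
    by (simp add: equations_def eqs_KD_def eqs_OU_def holds_def)
qed

lemma equations_EO:
  assumes "ED_space X" "OU_space X"
  shows "\<forall>(v, w)\<in>equations eqs_EO. holds X v w"
proof -
  have "\<forall>(v, w)\<in>equations eqs_ED \<union> equations eqs_OU. holds X v w"
    using equations_ED[OF assms(1)] equations_OU[OF assms(2)] by blast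
  then show ?thesis
    unfolding equations_def eqs_ED_def eqs_OU_def eqs_EO_def
    by (simp del: word_op_simps) (metis holds_sym holds_trans)
qed

lemma equations_P:
  assumes "P_space X"
  shows "\<forall>(v, w)\<in>equations eqs_P. holds X v w"
proof -
  have ib: "X interior_of (X closure_of A) = X closure_of A" if "A \<subseteq> topspace X" for A
    using assms that by (simp add: P_space_def holds_def)
  have bi: "X closure_of (X interior_of A) = X interior_of A" for A
  proof -
    have "topspace X - X closure_of (X interior_of A) = topspace X - X interior_of A"
      using ib[of "topspace X - A"] by (simp add: closure_of_complement interior_of_complement)
    then show ?thesis
      using closure_of_subset_topspace[of X "X interior_of A"]
        interior_of_subset_topspace[of X A] by blast
  qed
  have bf: "X closure_of (X frontier_of A) = X frontier_of A" for A
    by (simp add: closure_of_closedin closedin_frontier_of)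
  have i_f: "X interior_of (X frontier_of A) = X frontier_of A" for A
    using ib[of "X frontier_of A"] by (simp add: bf frontier_of_subset_topspace)
  have ff: "X frontier_of (X frontier_of A) = {}" for A
    by (simp add: frontier_of_def[of _ "X frontier_of _"] bf i_f)
  have fb: "X frontier_of (X closure_of A) = {}" if "A \<subseteq> topspace X" for A
    by (simp add: frontier_of_def ib that)
  have fi: "X frontier_of (X interior_of A) = {}" for A
    by (simp add: frontier_of_def bi)
  show ?thesis
    by (simp add: equations_def eqs_P_def holds_def ib bi bf i_f ff fb fi)
qed

lemma equations_D:
  assumes "D_space X"
  shows "\<forall>(v, w)\<in>equations eqs_D. holds X v w"
proof -
  have b: "X closure_of A = A" if "A \<subseteq> topspace X" for A
    using assms that by (simp add: D_space_def holds_def)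
  have i: "X interior_of A = A" if "A \<subseteq> topspace X" for A
    using b[of "topspace X - A"] that by (simp add: interior_of_closure_of double_diff)
  have f: "X frontier_of A = {}" if "A \<subseteq> topspace X" for A
    by (simp add: frontier_of_def b i that)
  show ?thesis
    by (simp add: equations_def eqs_D_def holds_def b i f)
qed

section \<open>Failing properties are witnessed by finite test spaces\<close>

lemma maps_openly_onto_point:
  assumes "topspace X \<noteq> {}"
  shows "maps_openly_onto X {2}"
proof -
  have "open_partial_map X (topspace X) (\<lambda>_. 2) {2}"
    using assms unfolding open_partial_map_def by (simp add: near_def image_constant_conv)
  then show ?thesis by (auto simp: maps_openly_onto_def)
qed

text \<open>
  An open set inside a frontier is split by \<open>A\<close> into two parts that are both dense in it. These parts
  will be the fibres of a map onto an indiscrete pair.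
\<close>

lemma open_subset_frontier:
  assumes "openin X U" "U \<subseteq> X frontier_of A"
  shows "U \<subseteq> X closure_of (U \<inter> A)" "U \<subseteq> X closure_of (U - A)"
proof -
  have U: "U \<subseteq> X closure_of A" "U \<subseteq> X closure_of (topspace X - A)"
    using assms(2) by (simp_all add: frontier_of_closures)
  show "U \<subseteq> X closure_of (U \<inter> A)"
    using openin_Int_closure_of_subset[OF assms(1), of A] U(1) by (simp add: Int_absorb2)
  have "U \<inter> (topspace X - A) = U - A"
    using openin_subset[OF assms(1)] by blast
  then show "U \<subseteq> X closure_of (U - A)"
    using openin_Int_closure_of_subset[OF assms(1), of "topspace X - A"] U(2)
    by (simp add: Int_absorb2)
qed

text \<open>
  The open set \<open>ifA\<close> maps onto \<open>{4, 5}\<close> by distinguishing points inside and outside \<open>A\<close>.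
\<close>

lemma maps_openly_onto_not_OU:
  assumes "\<not> OU_space X"
  shows "maps_openly_onto X {4, 5}"
proof -
  obtain A where A: "A \<subseteq> topspace X" "X interior_of (X frontier_of A) \<noteq> {}"
    using assms by (auto simp: OU_space_def holds_def)
  define U where "U = X interior_of (X frontier_of A)"
  define q :: "'a \<Rightarrow> nat" where "q = (\<lambda>x. if x \<in> A then 4 else 5)"
  have U: "openin X U" "U \<noteq> {}"
    using A by (auto simp: U_def)
  have dense: "U \<subseteq> X closure_of (U \<inter> A)" "U \<subseteq> X closure_of (U - A)"
    using open_subset_frontier[OF U(1), of A] by (simp_all add: U_def interior_of_subset)
  then have "U \<inter> A \<noteq> {}" "U - A \<noteq> {}"
    using U(2) by (metis closure_of_empty subset_empty)+
  then have "q ` U = {4, 5}"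
    by (auto simp: q_def image_iff)
  moreover have fibre: "{x\<in>U. q x = 4} = U \<inter> A" "{x\<in>U. q x = 5} = U - A"
    by (auto simp: q_def)
  moreover have "{x\<in>U. near s (q x)} = U" if "s \<in> {4, 5}" for s
    using that by (auto simp: q_def near_def)
  moreover have "x \<in> X closure_of {x'\<in>U. q x' = y}" if "x \<in> U" "y \<in> {4, 5}" for x y
    using that dense by (elim insertE) (auto simp: fibre)
  ultimately have "open_partial_map X U q {4, 5}"
    using U(1) openin_subset[OF U(1)] by (simp add: open_partial_map_def)
  then show ?thesis by (auto simp: maps_openly_onto_def)
qed

text \<open>
  If a closed set \<open>bA\<close> is not open, its frontier is a nonempty closed set with empty interior; map it to
  the closed point \<open>3\<close> and its complement to the open point \<open>2\<close>.
\<close>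

lemma maps_openly_onto_not_P:
  assumes "\<not> P_space X"
  shows "maps_openly_onto X {2, 3}"
proof -
  obtain A where A: "X interior_of (X closure_of A) \<noteq> X closure_of A"
    using assms by (auto simp: P_space_def holds_def)
  define C where "C = X frontier_of (X closure_of A)"
  define q :: "'a \<Rightarrow> nat" where "q = (\<lambda>x. if x \<in> C then 3 else 2)"
  have C: "closedin X C" "C \<noteq> {}"
    using A interior_of_subset[of X "X closure_of A"]
    by (simp_all add: C_def closedin_frontier_of) (simp add: frontier_of_def)
  have "X interior_of C = {}"
    by (simp add: C_def interior_of_frontier_of closure_of_subset interior_of_subset_topspace)
  then have dense: "X closure_of (topspace X - C) = topspace X"
    by (simp add: closure_of_complement)
  then have "topspace X - C \<noteq> {}"
    using C closedin_subset[OF C(1)] by (auto simp: closure_of_empty)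
  then have "q ` topspace X = {2, 3}"
    using C closedin_subset[OF C(1)] by (auto simp: q_def image_iff)
  moreover have "{x\<in>topspace X. q x = 2} = topspace X - C" "{x\<in>topspace X. q x = 3} = C"
    using closedin_subset[OF C(1)] by (auto simp: q_def)
  moreover have "{x\<in>topspace X. near 2 (q x)} = topspace X - C"
    "{x\<in>topspace X. near 3 (q x)} = topspace X"
    by (auto simp: q_def near_def)
  moreover have "x \<in> X closure_of C" if "near (q x) 3" for x
    using that C(1) by (simp add: q_def near_def closure_of_closedin split: if_splits)
  ultimately have "open_partial_map X (topspace X) q {2, 3}"
    using C(1) dense by (simp add: open_partial_map_def openin_diff)
  then show ?thesis by (auto simp: maps_openly_onto_def)
qed

text \<open>
  This supplies regular open sets: the lemma will be applied to the closed sets \<open>bA\<close> and \<open>fA\<close>.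
\<close>

lemma interior_of_closed_regular:
  assumes "closedin X C"
  shows "X interior_of (X closure_of (X interior_of C)) = X interior_of C"
proof
  show "X interior_of (X closure_of (X interior_of C)) \<subseteq> X interior_of C"
    by (intro interior_of_mono closure_of_minimal interior_of_subset assms)
  show "X interior_of C \<subseteq> X interior_of (X closure_of (X interior_of C))"
    by (intro interior_of_maximal closure_of_subset interior_of_subset_topspace openin_interior_of)
qed

text \<open>
  A regular open set \<open>U\<close> that is not closed splits the space into \<open>U\<close>, its boundary and its exterior.
  Send the boundary to \<open>3\<close> and the exterior to \<open>2\<close>. Regularity makes every boundary point a limit of the
  exterior, which is the openness of the map at \<open>3\<close>. On \<open>U\<close> itself the map may be constant or, when
  \<open>U\<close> has a partition into two dense parts, have both \<open>0\<close> and \<open>1\<close> as values.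
\<close>

lemma maps_openly_onto_regular_open:
  fixes h :: "'a \<Rightarrow> nat"
  assumes U: "openin X U" "X interior_of (X closure_of U) = U" "X closure_of U \<noteq> U"
    and h: "h ` U = H" "H \<subseteq> {0, 1}"
    and dense: "\<And>y. y \<in> H \<Longrightarrow> U \<subseteq> X closure_of {x\<in>U. h x = y}"
  shows "maps_openly_onto X (H \<union> {2, 3})"
proof -
  define q where "q = (\<lambda>x. if x \<in> U then h x else if x \<in> X closure_of U then 3 else 2)"
  have sub: "U \<subseteq> X closure_of U" "X closure_of U \<subseteq> topspace X"
    using closure_of_subset[OF openin_subset[OF U(1)]] closure_of_subset_topspace[of X U] .
  have boundary: "X closure_of U - U \<subseteq> X closure_of (topspace X - X closure_of U)"
    using U(2) sub by (auto simp: closure_of_complement)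
  have ne: "X closure_of U - U \<noteq> {}" "topspace X - X closure_of U \<noteq> {}"
    using U(3) sub boundary by auto
  have h_le: "h x \<le> 1" if "x \<in> U" for x
    using h that by force
  then have h_ne [simp]: "h x \<noteq> 2" "h x \<noteq> 3" if "x \<in> U" for x
    using that by force+
  have q: "q x = h x" if "x \<in> U" for x using that by (simp add: q_def)
  have fibre2: "{x\<in>topspace X. q x = 2} = topspace X - X closure_of U"
    using sub by (auto simp: q_def)
  have fibre3: "{x\<in>topspace X. q x = 3} = X closure_of U - U"
    using sub by (auto simp: q_def)
  have fibreH: "{x\<in>topspace X. q x = y} = {x\<in>U. h x = y}" if "y \<in> H" for y
    using sub h(2) that by (auto simp: q_def)
  have "q ` topspace X = H \<union> {2, 3}"
  proof
    show "q ` topspace X \<subseteq> H \<union> {2, 3}"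
      using h(1) by (auto simp: q_def)
    have "H = q ` U"
      unfolding h(1)[symmetric] using q by simp
    then have "H \<subseteq> q ` topspace X"
      using sub by blast
    moreover have "2 \<in> q ` topspace X" "3 \<in> q ` topspace X"
      using ne by (auto simp flip: fibre2 fibre3)
    ultimately show "H \<union> {2, 3} \<subseteq> q ` topspace X" by simp
  qed
  moreover have "openin X {x\<in>topspace X. near s (q x)}" if s: "s \<in> H \<union> {2, 3}" for s
  proof -
    consider "s \<le> 1" | "s = 2" | "s = 3" using s h(2) by auto
    then show ?thesis
    proof cases
      case 1
      then have "{x\<in>topspace X. near s (q x)} = U"
        using sub h_le by (auto simp: q_def near_def)
      then show ?thesis using U(1) by simp
    next
      case 2
      then have "{x\<in>topspace X. near s (q x)} = topspace X - X closure_of U"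
        using fibre2 by (simp add: near_def)
      then show ?thesis by (simp add: openin_diff)
    next
      case 3
      then have "{x\<in>topspace X. near s (q x)} = topspace X"
        using h_le by (force simp: q_def near_def)
      then show ?thesis by simp
    qed
  qed
  moreover have "x \<in> X closure_of {x'\<in>topspace X. q x' = y}"
    if x: "x \<in> topspace X" and y: "y \<in> H \<union> {2, 3}" and near: "near (q x) y" for x y
  proof (cases "q x = y")
    case True
    then show ?thesis
      using x closure_of_subset[of "{x'\<in>topspace X. q x' = y}" X] by blast
  next
    case False
    then have "x \<in> X closure_of U" "y \<in> H \<or> x \<notin> U \<and> y = 2"
      using near y h(2) h_le[of x] sub by (auto simp: q_def near_def split: if_splits)
    moreover have "X closure_of U \<subseteq> X closure_of {x\<in>U. h x = y}" if "y \<in> H"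
      using closure_of_mono[OF dense[OF that], of X] by simp
    ultimately show ?thesis
      using fibre2 fibreH[of y] boundary by auto
  qed
  ultimately have "open_partial_map X (topspace X) q (H \<union> {2, 3})"
    by (simp add: open_partial_map_def)
  then show ?thesis by (auto simp: maps_openly_onto_def)
qed

lemma maps_openly_onto_not_ED:
  assumes "\<not> ED_space X"
  shows "maps_openly_onto X {0, 2, 3}"
proof -
  obtain A where A: "X closure_of (X interior_of (X closure_of A)) \<noteq> X interior_of (X closure_of A)"
    using assms by (auto simp: ED_space_def holds_def)
  define U where "U = X interior_of (X closure_of A)"
  have U: "openin X U" "X interior_of (X closure_of U) = U" "X closure_of U \<noteq> U"
    using A by (simp_all add: U_def interior_of_closed_regular)
  then have "U \<noteq> {}" by auto
  then have "maps_openly_onto X ({0} \<union> {2, 3})"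
    using closure_of_subset[OF openin_subset[OF U(1)]]
    by (intro maps_openly_onto_regular_open[where h = "\<lambda>_. 0", OF U]) auto
  moreover have "{0} \<union> {2, 3} = {0, 2, 3 :: nat}" by auto
  ultimately show ?thesis by simp
qed

lemma maps_openly_onto_not_KD:
  assumes "\<not> KD_space X"
  shows "maps_openly_onto X {0, 1, 2, 3}"
proof -
  obtain A where A: "X closure_of (X interior_of (X frontier_of A)) \<noteq> X interior_of (X frontier_of A)"
    using assms by (auto simp: KD_space_def holds_def)
  define U where "U = X interior_of (X frontier_of A)"
  define h :: "'a \<Rightarrow> nat" where "h = (\<lambda>x. if x \<in> A then 0 else 1)"
  have U: "openin X U" "X interior_of (X closure_of U) = U" "X closure_of U \<noteq> U"
    using A by (simp_all add: U_def interior_of_closed_regular closedin_frontier_of)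
  have dense: "U \<subseteq> X closure_of (U \<inter> A)" "U \<subseteq> X closure_of (U - A)"
    using open_subset_frontier[OF U(1), of A] by (simp_all add: U_def interior_of_subset)
  have "U \<noteq> {}" using U(3) by auto
  then have ne: "U \<inter> A \<noteq> {}" "U - A \<noteq> {}"
    using dense by (metis closure_of_empty subset_empty)+
  have "{x\<in>U. h x = 0} = U \<inter> A" "{x\<in>U. h x = 1} = U - A"
    by (auto simp: h_def)
  moreover have "h ` U = {0, 1}"
    using ne by (auto simp: h_def image_iff)
  ultimately have "maps_openly_onto X ({0, 1} \<union> {2, 3})"
    using dense by (intro maps_openly_onto_regular_open[where h = h, OF U]) auto
  then show ?thesis by (simp add: insert_commute)
qed

section \<open>The collapse of a space\<close>

definition separated :: "kf_word list list \<Rightarrow> (nat set \<times> nat set) list \<Rightarrow> bool" where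
  "separated cs ts \<longleftrightarrow> (\<forall>v\<in>KF0. \<forall>w\<in>KF0.
     (\<forall>(S, B)\<in>set ts. fin_word_op S v B = fin_word_op S w B) \<longrightarrow> same_chain cs v w)"

lemma presentsI:
  assumes "topspace X \<noteq> {}" "well_formed cs" "\<forall>(v, w)\<in>equations cs. holds X v w"
    and "separated cs ts" "\<forall>(S, B)\<in>set ts. maps_openly_onto X S \<and> B \<subseteq> S"
  shows "presents X cs"
proof -
  have "same_chain cs v w" if vw: "v \<in> KF0" "w \<in> KF0" "holds X v w" for v w
  proof -
    have "fin_word_op S v B = fin_word_op S w B" if "(S, B) \<in> set ts" for S B
      using bspec[OF assms(5) that] equation_inherited[OF _ vw(3)] by simp
    then have "\<forall>(S, B)\<in>set ts. fin_word_op S v B = fin_word_op S w B"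
      by fast
    moreover have "(\<forall>(S, B)\<in>set ts. fin_word_op S v B = fin_word_op S w B) \<longrightarrow> same_chain cs v w"
      using bspec[OF bspec[OF assms(4)[unfolded separated_def] vw(1)] vw(2)] .
    ultimately show ?thesis by (rule rev_mp)
  qed
  then show ?thesis
    unfolding presents_def by (intro conjI assms(1-3) ballI impI)
qed

definition chains_of :: "'a topology \<Rightarrow> kf_word list list" where
  "chains_of X =
     (if D_space X then eqs_D
      else if P_space X then eqs_P
      else if ED_space X then if OU_space X then eqs_EO else eqs_ED
      else if OU_space X then eqs_OU
      else if KD_space X then eqs_KD
      else [])"

text \<open>
  The subset \<open>B\<close> of each test space is chosen so that its values tell apart as many words as possible:
  an open point, the closed point \<open>3\<close> of the Sierpinski space, or one point of an indiscrete pair. In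
  the list for P the whole pair \<open>{4, 5}\<close> is needed as well, since it distinguishes \<open>i\<close> from \<open>0\<close>. In the
  last list \<open>{0, 1, 2, 3}\<close> takes over from \<open>{4, 5}\<close>, because it contains an open indiscrete pair.
\<close>

lemma separated_D: "separated eqs_D [({2}, {2})]"
  by code_simp

lemma separated_P: "separated eqs_P [({4, 5}, {4}), ({4, 5}, {4, 5})]"
  by code_simp

lemma separated_EO: "separated eqs_EO [({2, 3}, {2}), ({2, 3}, {3})]"
  by code_simp

lemma separated_OU: "separated eqs_OU [({2, 3}, {2}), ({2, 3}, {3}), ({0, 2, 3}, {0})]"
  by code_simp

lemma separated_ED: "separated eqs_ED [({2, 3}, {2}), ({2, 3}, {3}), ({4, 5}, {4})]"
  by code_simp

lemma separated_KD:
  "separated eqs_KD [({2, 3}, {2}), ({2, 3}, {3}), ({0, 2, 3}, {0}), ({4, 5}, {4})]"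
  by code_simp

lemma separated_nil:
  "separated [] [({2, 3}, {2}), ({2, 3}, {3}), ({0, 2, 3}, {0}), ({0, 1, 2, 3}, {0})]"
  by code_simp

lemma well_formed_eqs:
  "well_formed eqs_D" "well_formed eqs_P" "well_formed eqs_EO" "well_formed eqs_OU"
  "well_formed eqs_ED" "well_formed eqs_KD" "well_formed []"
  by code_simp+

text \<open>
  In each case the equations come from the properties that hold, and the separation from the test spaces
  of properties that fail or, in the case of D, from the one-point space. In the case of P the failing
  property is OU, since P and OU together imply D.
\<close>

theorem presents_chains:
  assumes "topspace X \<noteq> {}"
  shows "presents X (chains_of X)"
proof -
  consider "D_space X"
    | "\<not> D_space X" "P_space X"
    | "\<not> D_space X" "\<not> P_space X" "ED_space X" "OU_space X"
    | "\<not> D_space X" "\<not> P_space X" "ED_space X" "\<not> OU_space X"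
    | "\<not> D_space X" "\<not> P_space X" "\<not> ED_space X" "OU_space X"
    | "\<not> D_space X" "\<not> P_space X" "\<not> ED_space X" "\<not> OU_space X" "KD_space X"
    | "\<not> D_space X" "\<not> P_space X" "\<not> ED_space X" "\<not> OU_space X" "\<not> KD_space X"
    by blast
  then show ?thesis
  proof cases
    case 1
    have "presents X eqs_D"
      by (rule presentsI[OF assms well_formed_eqs(1) equations_D[OF 1] separated_D])
        (simp add: maps_openly_onto_point[OF assms])
    with 1 show ?thesis by (simp add: chains_of_def)
  next
    case 2
    then have no_OU: "\<not> OU_space X"
      using D_of_P_OU by blast
    have "presents X eqs_P"
      by (rule presentsI[OF assms well_formed_eqs(2) equations_P[OF 2(2)] separated_P])
        (simp add: maps_openly_onto_not_OU[OF no_OU])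
    with 2 show ?thesis by (simp add: chains_of_def)
  next
    case 3
    have "presents X eqs_EO"
      by (rule presentsI[OF assms well_formed_eqs(3) equations_EO[OF 3(3,4)] separated_EO])
        (simp add: maps_openly_onto_not_P[OF 3(2)])
    with 3 show ?thesis by (simp add: chains_of_def)
  next
    case 4
    have "presents X eqs_ED"
      by (rule presentsI[OF assms well_formed_eqs(5) equations_ED[OF 4(3)] separated_ED])
        (simp add: maps_openly_onto_not_P[OF 4(2)] maps_openly_onto_not_OU[OF 4(4)])
    with 4 show ?thesis by (simp add: chains_of_def)
  next
    case 5
    have "presents X eqs_OU"
      by (rule presentsI[OF assms well_formed_eqs(4) equations_OU[OF 5(4)] separated_OU])
        (simp add: maps_openly_onto_not_P[OF 5(2)] maps_openly_onto_not_ED[OF 5(3)])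
    with 5 show ?thesis by (simp add: chains_of_def)
  next
    case 6
    have "presents X eqs_KD"
      by (rule presentsI[OF assms well_formed_eqs(6) equations_KD[OF 6(5)] separated_KD])
        (simp add: maps_openly_onto_not_P[OF 6(2)] maps_openly_onto_not_ED[OF 6(3)] maps_openly_onto_not_OU[OF 6(4)])
    with 6 show ?thesis by (simp add: chains_of_def)
  next
    case 7
    have no_equations: "\<forall>(v, w)\<in>equations []. holds X v w"
      by (simp add: equations_def)
    have "presents X []"
      by (rule presentsI[OF assms well_formed_eqs(7) no_equations separated_nil])
        (use maps_openly_onto_not_P[OF 7(2)] maps_openly_onto_not_ED[OF 7(3)] maps_openly_onto_not_KD[OF 7(5)] in simp)
    with 7 show ?thesis by (simp add: chains_of_def)
  qed
qed

lemma collapse_of_chains: "topspace X \<noteq> {} \<Longrightarrow> collapse_of X = generated_collapse (chains_of X)"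
  by (simp add: collapse_of_presented presents_chains)

lemma KF_number_chains:
  "topspace X \<noteq> {} \<Longrightarrow> KF_number X = 2 * card (KF0 - redundant (chains_of X))"
  by (simp add: KF_number_presented presents_chains)

section \<open>Realisation of the seven collapses\<close>

definition all_chains :: "kf_word list list set" where
  "all_chains = {[], eqs_KD, eqs_ED, eqs_OU, eqs_EO, eqs_P, eqs_D}"

lemma chains_test_space:
  "chains_of (test_space {2}) = eqs_D" "chains_of (test_space {4, 5}) = eqs_P"
  "chains_of (test_space {2, 3}) = eqs_EO" "chains_of (test_space {0, 2, 3}) = eqs_OU"
  "chains_of (test_space {0, 1, 3}) = eqs_ED" "chains_of (test_space {0, 2, 3, 4, 5}) = eqs_KD"
  "chains_of (test_space {0, 1, 2, 3}) = []"
  unfolding chains_of_def D_space_def P_space_def ED_space_def OU_space_def KD_space_def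
    holds_test_space
  by code_simp+

lemma chains_realised:
  assumes "cs \<in> all_chains"
  obtains X :: "nat topology" where "topspace X \<noteq> {}" "chains_of X = cs"
proof -
  have "\<exists>S. S \<noteq> {} \<and> chains_of (test_space S) = cs"
    using assms chains_test_space unfolding all_chains_def by (metis insertE insert_not_empty emptyE)
  then show ?thesis
    using that by (metis topspace_test_space)
qed

lemma card_irredundant:
  "(\<lambda>cs. 2 * card (KF0 - redundant cs)) ` all_chains = {4, 10, 16, 20, 22, 28, 34}"
  by code_simp

lemma card_all_chains: "card all_chains = 7"
  by code_simp

lemma chains_of_in_all_chains: "chains_of X \<in> all_chains"
  by (simp add: chains_of_def all_chains_def)

text \<open>
  The predicate \<open>presents X\<close> depends on \<open>X\<close> only through its collapse. So two lists that generate the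
  same collapse give the same number of operators, and these numbers differ for the seven lists.
\<close>

lemma presents_transfer:
  assumes "presents Y cs" "topspace X \<noteq> {}" "collapse_of X = collapse_of Y"
  shows "presents X cs"
proof -
  have holds: "holds X v w \<longleftrightarrow> holds Y v w" if "v \<in> KF" "w \<in> KF" for v w
  proof (cases "v = w")
    case True
    then show ?thesis by (simp add: holds_def)
  next
    case False
    then show ?thesis using that assms(3) collapse_of_iff by metis
  qed
  have wf: "well_formed cs"
    using assms(1) by (simp add: presents_def)
  have KF: "v \<in> KF" if "v \<in> KF0" for v
    using that by (simp add: KF_def)
  have "holds X v w" if "(v, w) \<in> equations cs" for v w
    using that equations_KF0[OF wf that] assms(1) holds KF by (auto simp: presents_def)
  then show ?thesis
    using assms(1,2) holds KF by (auto simp: presents_def)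
qed

lemma inj_generated_collapse: "inj_on generated_collapse all_chains"
proof (rule inj_onI)
  fix cs cs' assume cs: "cs \<in> all_chains" "cs' \<in> all_chains"
    and eq: "generated_collapse cs = generated_collapse cs'"
  obtain X :: "nat topology" where X: "topspace X \<noteq> {}" "chains_of X = cs"
    using chains_realised[OF cs(1)] .
  obtain Y :: "nat topology" where Y: "topspace Y \<noteq> {}" "chains_of Y = cs'"
    using chains_realised[OF cs(2)] .
  have "presents X cs'"
    using presents_transfer[of Y cs' X] presents_chains[OF Y(1)] X Y eq
    by (simp add: collapse_of_chains)
  then have "2 * card (KF0 - redundant cs) = 2 * card (KF0 - redundant cs')"
    using KF_number_presented[of X] presents_chains[OF X(1)] X(2) by metis
  moreover have "inj_on (\<lambda>cs. 2 * card (KF0 - redundant cs)) all_chains"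
    by (rule eq_card_imp_inj_on)
      (simp_all only: card_irredundant card_all_chains, simp_all add: all_chains_def)
  ultimately show "cs = cs'"
    using cs by (intro inj_onD[of _ all_chains cs cs'])
qed

lemma generated_empty: "generated_collapse [] = {}"
proof -
  have "v = w" if "(v, w) \<in> word_equiv {}" for v w
    using that by induction auto
  then show ?thesis by (auto simp: generated_collapse_def equations_def)
qed

lemma global_collapse_iff:
  "global_collapse TYPE('b) C \<longleftrightarrow>
     (\<exists>X :: 'b topology. topspace X \<noteq> {} \<and> C = generated_collapse (chains_of X))"
  using satisfies_iff collapse_of_chains unfolding global_collapse_def by metis

theorem theorem3:
  "let collapses = {{}, generated_collapse eqs_KD, generated_collapse eqs_ED,
                    generated_collapse eqs_OU, generated_collapse eqs_EO,
                    generated_collapse eqs_P, generated_collapse eqs_D};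
       numbers = {4, 10, 16, 20, 22, 28, 34}
   in card collapses = 7
    \<and> {C. global_collapse TYPE('a) C} \<subseteq> collapses
    \<and> {C. global_collapse TYPE(nat) C} = collapses
    \<and> KF_numbers TYPE('a) \<subseteq> numbers
    \<and> KF_numbers TYPE(nat) = numbers"
proof -
  let ?number = "\<lambda>cs. 2 * card (KF0 - redundant cs)"
  have collapses: "{{}, generated_collapse eqs_KD, generated_collapse eqs_ED,
      generated_collapse eqs_OU, generated_collapse eqs_EO,
      generated_collapse eqs_P, generated_collapse eqs_D} = generated_collapse ` all_chains"
    by (simp add: all_chains_def generated_empty)
  have "card (generated_collapse ` all_chains) = 7"
    using card_image[OF inj_generated_collapse] card_all_chains by simp
  moreover have "{C. global_collapse TYPE('a) C} \<subseteq> generated_collapse ` all_chains"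
    using chains_of_in_all_chains by (auto simp: global_collapse_iff)
  moreover have "{C. global_collapse TYPE(nat) C} = generated_collapse ` all_chains"
  proof
    show "{C. global_collapse TYPE(nat) C} \<subseteq> generated_collapse ` all_chains"
      using chains_of_in_all_chains by (auto simp: global_collapse_iff)
    show "generated_collapse ` all_chains \<subseteq> {C. global_collapse TYPE(nat) C}"
    proof
      fix C assume "C \<in> generated_collapse ` all_chains"
      then obtain cs where "cs \<in> all_chains" "C = generated_collapse cs" by blast
      moreover from this obtain X :: "nat topology" where "topspace X \<noteq> {}" "chains_of X = cs"
        using chains_realised by blast
      ultimately show "C \<in> {C. global_collapse TYPE(nat) C}"
        by (auto simp: global_collapse_iff)
    qed
  qed
  moreover have "KF_numbers TYPE('a) \<subseteq> ?number ` all_chains"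
    using KF_number_chains chains_of_in_all_chains by (fastforce simp: KF_numbers_def)
  moreover have "KF_numbers TYPE(nat) = ?number ` all_chains"
  proof
    show "KF_numbers TYPE(nat) \<subseteq> ?number ` all_chains"
      using KF_number_chains chains_of_in_all_chains by (fastforce simp: KF_numbers_def)
    show "?number ` all_chains \<subseteq> KF_numbers TYPE(nat)"
    proof
      fix n assume "n \<in> ?number ` all_chains"
      then obtain cs where "cs \<in> all_chains" "n = ?number cs" by blast
      moreover from this obtain X :: "nat topology" where "topspace X \<noteq> {}" "chains_of X = cs"
        using chains_realised by blast
      ultimately have "n = KF_number X \<and> topspace X \<noteq> {}"
        using KF_number_chains[of X] by simp
      then show "n \<in> KF_numbers TYPE(nat)"
        unfolding KF_numbers_def by blast
    qed
  qed
  ultimately show ?thesis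
    unfolding Let_def collapses card_irredundant by blast
qed

end
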